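(* Let $T$ be a triangle with vertices $y_1,y_2,y_3$, let $r\in[1,\infty)$ and let $M$ be a point of the interior $(\mathscr{T}_r)^o$ of $\mathscr{T}_r$ (this requires $r<3/2$). Let $\gamma_n(r,M)$ be the domination number of the $r$-factor proportional-edge proximity catch digraph with $M$-vertex regions on $n$ iid points uniformly distributed on $T$. Then $P(\gamma_n(r,M)=3)\to1$ as $n\to\infty$.
   Context: Let $y_1,y_2,y_3\in\mathbb{R}^2$ be non-collinear, $T$ the closed triangle with these vertices, $e_j$ the edge opposite $y_j$, and $b_j(x)$ the barycentric coordinate of $x\in T$ with respect to $y_j$. Define $\mathscr{T}_r:=\{x\in T: b_j(x)\ge 1-1/r \text{ for } j=1,2,3\}$, the triangle bounded by the lines $q_j$ parallel to $e_j$ with $d(y_j,e_j)=r\,d(y_j,q_j)$ (nonempty interior iff $r<3/2$). For $M$ in the interior of $T$ and $k=1,2,3$, let $M_k$ be the point where the line through $y_k$ and $M$ meets $e_k$; the $M$-vertex region $R_M(y_j)$ is the closed quadrilateral with vertices $y_j,M_k,M,M_l$, $\{j,k,l\}=\{1,2,3\}$. For $x\in T\setminus\{y_1,y_2,y_3\}$ let $v(x)=y_j$ where $x\in R_M(y_j)$ (arbitrary choice on common boundaries). For such $x$ with $v(x)=y_j$, $N^r_{PE}(x,M)=\{z\in T: 1-b_j(z)\le r(1-b_j(x))\}$ (the intersection with $T$ of the triangle similar to $T$ with vertex $y_j$ whose opposite side is parallel to $e_j$ at $r$ times the distance from $y_j$ to the line through $x$ parallel to $e_j$); $N^r_{PE}(y_j,M)=\{y_j\}$.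 The digraph on $\{X_1,\dots,X_n\}$ has an arc $X_i\to X_j$ ($i\ne j$) iff $X_j\in N^r_{PE}(X_i,M)$; the domination number is the minimum cardinality of a vertex set $S$ such that every vertex is in $S$ or is the head of an arc from $S$. *)

theory Defs
  imports "HOL-Probability.Probability" "Graph_Theory.Pair_Digraph"
begin

text \<open>A triangle is given by its vertex map \<open>y\<close> on the three-element index type \<open>3\<close>.\<close>

definition closed_triangle :: "(3 \<Rightarrow> real^2) \<Rightarrow> (real^2) set" where
  "closed_triangle y = convex hull (range y)"

definition opp_edge :: "(3 \<Rightarrow> real^2) \<Rightarrow> 3 \<Rightarrow> (real^2) set" where
  "opp_edge y j = convex hull (y ` (- {j}))"

text \<open>Well defined (unique existence on the whole plane) when the vertices are not collinear.\<close>

definition bary :: "(3 \<Rightarrow> real^2) \<Rightarrow> real^2 \<Rightarrow> 3 \<Rightarrow> real" where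
  "bary y x = (THE b. (\<Sum>j\<in>UNIV. b j) = 1 \<and> (\<Sum>j\<in>UNIV. b j *\<^sub>R y j) = x)"

definition inner_triangle :: "(3 \<Rightarrow> real^2) \<Rightarrow> real \<Rightarrow> (real^2) set" where
  "inner_triangle y r = {x \<in> closed_triangle y. \<forall>j. bary y x j \<ge> 1 - 1 / r}"

text \<open>The point \<open>M\<^sub>k\<close>, which is unique for \<open>M\<close> in the interior of the triangle.\<close>

definition cevian_foot :: "(3 \<Rightarrow> real^2) \<Rightarrow> real^2 \<Rightarrow> 3 \<Rightarrow> real^2" where
  "cevian_foot y M k = (THE p. p \<in> affine hull {y k, M} \<and> p \<in> opp_edge y k)"

text \<open>
  For \<open>M\<close> in the interior of the triangle, the quadrilateral with vertices
  \<open>y\<^sub>j\<close>, \<open>M\<^sub>k\<close>, \<open>M\<close>, \<open>M\<^sub>l\<close> is convex, hence equal to the hull of its vertices.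
\<close>

definition vertex_region :: "(3 \<Rightarrow> real^2) \<Rightarrow> real^2 \<Rightarrow> 3 \<Rightarrow> (real^2) set" where
  "vertex_region y M j = convex hull ({y j, M} \<union> cevian_foot y M ` (- {j}))"

text \<open>
  The map \<open>v\<close> assigns to a point of the triangle the index of the vertex whose region it is
  assigned to; its values at the vertices themselves are never used.
\<close>

definition vertex_assignment :: "(3 \<Rightarrow> real^2) \<Rightarrow> real^2 \<Rightarrow> (real^2 \<Rightarrow> 3) \<Rightarrow> bool" where
  "vertex_assignment y M v \<longleftrightarrow> (\<forall>x \<in> closed_triangle y - range y. x \<in> vertex_region y M (v x))"

definition pe_region :: "(3 \<Rightarrow> real^2) \<Rightarrow> (real^2 \<Rightarrow> 3) \<Rightarrow> real \<Rightarrow> real^2 \<Rightarrow> (real^2) set" where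
  "pe_region y v r x =
     (if x \<in> range y then {x}
      else {z \<in> closed_triangle y. 1 - bary y z (v x) \<le> r * (1 - bary y x (v x))})"

definition pe_digraph ::
    "(3 \<Rightarrow> real^2) \<Rightarrow> (real^2 \<Rightarrow> 3) \<Rightarrow> real \<Rightarrow> (real^2) set \<Rightarrow> (real^2) pair_pre_digraph" where
  "pe_digraph y v r V =
     \<lparr> pverts = V, parcs = {(x, z). x \<in> V \<and> z \<in> V \<and> x \<noteq> z \<and> z \<in> pe_region y v r x} \<rparr>"

definition dominating_set :: "('a, 'b) pre_digraph \<Rightarrow> 'a set \<Rightarrow> bool" where
  "dominating_set G S \<longleftrightarrow>
     S \<subseteq> verts G \<and> (\<forall>w \<in> verts G. w \<in> S \<or> (\<exists>u \<in> S. u \<rightarrow>\<^bsub>G\<^esub> w))"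

definition domination_number :: "('a, 'b) pre_digraph \<Rightarrow> nat" where
  "domination_number G = (LEAST k. \<exists>S. finite S \<and> dominating_set G S \<and> card S = k)"

end

theory Submission
  imports Defs
begin

text \<open>
  Let \<open>m\<close> be the barycentric coordinates of \<open>M\<close>. In the region of \<open>y j\<close> the ratio
  \<open>b j / m j\<close> is the largest of the three; as both families of coordinates sum to 1, this forces
  \<open>b j \<ge> m j\<close> there. Hence the proximity region of a point assigned to \<open>y j\<close> misses the strip
  \<open>b j < 1 - r * (1 - m j)\<close> along the opposite edge, and this strip is nonempty because \<open>M\<close> is
  interior to the inner triangle. Two strips meet in a corner of positive area at a vertex, so once
  every corner contains a data point, no two points dominate. This fails with probability at most
  a sum of three geometric terms. Conversely, choosing in each vertex region the data point closest
  to the opposite edge always dominates with at most three points.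
\<close>

section \<open>Barycentric coordinates of a nondegenerate triangle\<close>

text \<open>Cramer's rule gives explicit coordinates, so the \<open>THE\<close> in
  \<open>bary\<close> is well defined on the whole plane. The affine form is what later yields
  continuity, measurability and convexity.\<close>

lemma bary_properties:
  fixes y :: "3 \<Rightarrow> real^2"
  assumes "\<not> collinear (range y)"
  shows bary_affine: "\<exists>a c. \<forall>x j. bary y x j = a j \<bullet> x + c j"
    and sum_bary: "(\<Sum>j\<in>UNIV. bary y x j) = 1"
    and bary_combination: "(\<Sum>j\<in>UNIV. bary y x j *\<^sub>R y j) = x"
    and bary_unique: "\<And>b. (\<Sum>j\<in>UNIV. b j) = 1 \<Longrightarrow> (\<Sum>j\<in>UNIV. b j *\<^sub>R y j) = x \<Longrightarrow> bary y x = b"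
proof -
  define cr :: "real^2 \<Rightarrow> real^2 \<Rightarrow> real" where "cr u w = u$1 * w$2 - u$2 * w$1" for u w
  \<comment> \<open>Twice a signed area of the triangle; noncollinearity enters only through
    \<open>D\<close> being nonzero.\<close>
  define D where "D = cr (y 1 - y 2) (y 3 - y 2)"
  have rng: "range y = {y 1, y 2, y 3}" using exhaust_3 by (auto simp: UNIV_3)
  have "D \<noteq> 0"
  proof
    assume "D = 0"
    let ?u = "y 1 - y 2" and ?w = "y 3 - y 2"
    \<comment> \<open>Lagrange's identity: if \<open>D = 0\<close>, equality holds in
      Cauchy-Schwarz, which forces collinearity.\<close>
    have "(?u \<bullet> ?w)\<^sup>2 + D\<^sup>2 = (?u \<bullet> ?u) * (?w \<bullet> ?w)"
      unfolding D_def cr_def inner_vec_def by (simp add: sum_2 power2_eq_square algebra_simps)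
    then have "(?u \<bullet> ?w)\<^sup>2 = (norm ?u * norm ?w)\<^sup>2"
      using \<open>D = 0\<close> by (simp add: power_mult_distrib dot_square_norm)
    then have "\<bar>?u \<bullet> ?w\<bar> = norm ?u * norm ?w"
      by (intro power2_eq_imp_eq[of "\<bar>?u \<bullet> ?w\<bar>"]) simp_all
    then have "collinear {0, ?u, ?w}" using norm_cauchy_schwarz_equal by blast
    then have "collinear {y 1, y 2, y 3}" by (simp add: collinear_3)
    then show False using assms rng by simp
  qed
  \<comment> \<open>Signed area with \<open>y j\<close> replaced by \<open>x\<close>, relative to
    that of the whole triangle.\<close>
  define B where "B x j = (if j = 1 then cr (x - y 2) (y 3 - y 2)
     else if j = 2 then cr (x - y 3) (y 1 - y 3) else cr (x - y 1) (y 2 - y 1)) / D" for x and j :: 3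
  have ne: "(1::3) \<noteq> 2" "(1::3) \<noteq> 3" "(2::3) \<noteq> 3" by simp_all
  have D2: "cr (x - y 2) (y 3 - y 2) + cr (x - y 3) (y 1 - y 3) + cr (x - y 1) (y 2 - y 1) = D" for x
    unfolding D_def cr_def by (simp add: algebra_simps)
  have Bsum: "(\<Sum>j\<in>UNIV. B x j) = 1" for x
    using D2[of x] \<open>D \<noteq> 0\<close> ne by (simp add: sum_3 B_def flip: add_divide_distrib)
  have "D *\<^sub>R (\<Sum>j\<in>UNIV. B x j *\<^sub>R y j) = D *\<^sub>R x" for x
  proof -
    \<comment> \<open>The divisions are cancelled while \<open>D\<close> is still folded, which
      leaves a polynomial identity.\<close>
    have *: "D * (z / D) = z" for z using \<open>D \<noteq> 0\<close> by simp
    show ?thesis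
      unfolding vec_eq_iff forall_2 sum_3 B_def using ne
      by (simp add: ring_distribs(1) mult.assoc[symmetric] *) (simp add: D_def cr_def algebra_simps)
  qed
  then have Bcomb: "(\<Sum>j\<in>UNIV. B x j *\<^sub>R y j) = x" for x using \<open>D \<noteq> 0\<close> by simp
  have uniq: "b = B x" if b: "(\<Sum>j\<in>UNIV. b j) = 1" "(\<Sum>j\<in>UNIV. b j *\<^sub>R y j) = x" for b x
  proof -
    have b1: "b 1 = 1 - b 2 - b 3" using b(1) by (simp add: sum_3)
    have x: "x $ i = b 1 * y 1 $ i + b 2 * y 2 $ i + b 3 * y 3 $ i" for i
      unfolding b(2)[symmetric] by (simp add: sum_3)
    have "b j * D = B x j * D" for j
    proof -
      have *: "B x j * D = (if j = 1 then cr (x - y 2) (y 3 - y 2)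
         else if j = 2 then cr (x - y 3) (y 1 - y 3) else cr (x - y 1) (y 2 - y 1))"
        using \<open>D \<noteq> 0\<close> by (simp add: B_def)
      show ?thesis unfolding * using exhaust_3[of j] ne
        by (auto simp: D_def cr_def x b1) (simp_all add: algebra_simps)
    qed
    then show ?thesis using \<open>D \<noteq> 0\<close> by auto
  qed
  have bary: "bary y x = B x" for x
    unfolding bary_def by (rule the_equality) (auto simp: Bsum Bcomb uniq)
  show "(\<Sum>j\<in>UNIV. bary y x j) = 1" "(\<Sum>j\<in>UNIV. bary y x j *\<^sub>R y j) = x"
    by (simp_all add: bary Bsum Bcomb)
  show "bary y x = b" if "(\<Sum>j\<in>UNIV. b j) = 1" "(\<Sum>j\<in>UNIV. b j *\<^sub>R y j) = x" for b
    using uniq[OF that] bary by simp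
  have aff: "\<exists>a c. \<forall>x. cr (x - u) w / D = a \<bullet> x + c" for u w
    by (rule exI[of _ "vector [w$2 / D, - w$1 / D]"], rule exI[of _ "- cr u w / D"])
       (simp add: cr_def inner_vec_def sum_2 algebra_simps diff_divide_distrib add_divide_distrib)
  have "\<exists>a c. \<forall>x. B x j = a \<bullet> x + c" for j
    using exhaust_3[of j] ne by (auto simp: B_def aff)
  then show "\<exists>a c. \<forall>x j. bary y x j = a j \<bullet> x + c j"
    unfolding bary by metis
qed

locale triangle =
  fixes y :: "3 \<Rightarrow> real^2"
  assumes noncollinear: "\<not> collinear (range y)"
begin

text \<open>The weights may be negative: points beyond \<open>M\<close> on a line through a vertex
  are needed for the cevian feet and for the interior of the inner triangle.\<close>

lemma bary_affine_comb:
  assumes "u + w = 1"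
  shows "bary y (u *\<^sub>R x + w *\<^sub>R z) j = u * bary y x j + w * bary y z j"
proof -
  obtain a c where ac: "\<And>x j. bary y x j = a j \<bullet> x + c j"
    using bary_affine[OF noncollinear] by blast
  have "c j = (u + w) * c j" using assms by simp
  then show ?thesis by (simp add: ac algebra_simps)
qed

lemma bary_vertex: "bary y (y k) j = (if j = k then 1 else 0)"
proof -
  have "bary y (y k) = (\<lambda>j. if j = k then 1 else 0)"
    by (rule bary_unique[OF noncollinear]) (simp_all add: if_distrib[of "\<lambda>c. c *\<^sub>R _"] cong: if_cong)
  then show ?thesis by simp
qed

lemma continuous_on_bary: "continuous_on A (\<lambda>x. bary y x j)"
proof -
  obtain a c where "\<And>x j. bary y x j = a j \<bullet> x + c j"
    using bary_affine[OF noncollinear] by blast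
  then show ?thesis by (simp add: continuous_intros)
qed

lemma borel_measurable_bary [measurable]: "(\<lambda>x. bary y x j) \<in> borel_measurable borel"
  by (intro borel_measurable_continuous_onI continuous_on_bary)

text \<open>This homogeneous form covers sign conditions on one coordinate (\<open>s = 0\<close> or
  \<open>t = 0\<close>) as well as comparisons of ratios.\<close>

lemma convex_bary_le: "convex {x. s * bary y x j \<le> t * bary y x k}"
proof (rule convexI)
  fix x z and u w :: real
  assume h: "x \<in> {x. s * bary y x j \<le> t * bary y x k}" "z \<in> {x. s * bary y x j \<le> t * bary y x k}"
    "0 \<le> u" "0 \<le> w" "u + w = 1"
  then have "u * (s * bary y x j) + w * (s * bary y z j) \<le> u * (t * bary y x k) + w * (t * bary y z k)"
    by (intro add_mono mult_left_mono) auto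
  then show "u *\<^sub>R x + w *\<^sub>R z \<in> {x. s * bary y x j \<le> t * bary y x k}"
    using h(5) by (simp add: bary_affine_comb algebra_simps)
qed

lemma closed_triangle_eq: "closed_triangle y = {x. \<forall>j. 0 \<le> bary y x j}"
proof (intro equalityI subsetI)
  fix x assume x: "x \<in> closed_triangle y"
  have "convex {x. 0 \<le> bary y x j}" for j using convex_bary_le[of 0 j 1 j] by simp
  then have "closed_triangle y \<subseteq> {x. 0 \<le> bary y x j}" for j
    unfolding closed_triangle_def by (intro hull_minimal) (auto simp: bary_vertex)
  with x show "x \<in> {x. \<forall>j. 0 \<le> bary y x j}" by auto
next
  fix x assume "x \<in> {x. \<forall>j. 0 \<le> bary y x j}"
  then have "(\<Sum>j\<in>UNIV. bary y x j *\<^sub>R y j) \<in> closed_triangle y"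
    unfolding closed_triangle_def
    by (intro convex_sum) (auto simp: sum_bary[OF noncollinear] intro: hull_inc)
  then show "x \<in> closed_triangle y" by (simp add: bary_combination[OF noncollinear])
qed

lemma opp_edge_eq: "opp_edge y k = {x \<in> closed_triangle y. bary y x k = 0}"
proof (intro equalityI subsetI)
  fix x assume x: "x \<in> opp_edge y k"
  have "convex {x. bary y x k \<le> 0}" using convex_bary_le[of 1 k 0 k] by simp
  then have "opp_edge y k \<subseteq> {x. bary y x k \<le> 0}"
    unfolding opp_edge_def by (intro hull_minimal) (auto simp: bary_vertex)
  moreover have "opp_edge y k \<subseteq> closed_triangle y"
    unfolding opp_edge_def closed_triangle_def by (rule hull_mono) auto
  ultimately have "bary y x k \<le> 0" "x \<in> closed_triangle y" using x by auto
  then show "x \<in> {x \<in> closed_triangle y. bary y x k = 0}"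
    by (auto simp: closed_triangle_eq intro: antisym)
next
  fix x assume x: "x \<in> {x \<in> closed_triangle y. bary y x k = 0}"
  have *: "(\<Sum>j\<in>UNIV. h j) = h k + (\<Sum>j\<in>-{k}. h j)" for h :: "3 \<Rightarrow> 'b::comm_monoid_add"
    by (subst sum.remove[of _ k]) (auto simp: Compl_eq_Diff_UNIV)
  have "(\<Sum>j\<in>-{k}. bary y x j *\<^sub>R y j) \<in> opp_edge y k"
    unfolding opp_edge_def using x sum_bary[OF noncollinear, of x]
    by (intro convex_sum) (auto simp: closed_triangle_eq * intro: hull_inc)
  then show "x \<in> opp_edge y k"
    using bary_combination[OF noncollinear, of x] x by (simp add: *)
qed

lemma bary_less_1:
  assumes "\<And>j. 0 < bary y x j"
  shows "bary y x k < 1"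
  using sum_bary[OF noncollinear, of x] assms[of 1] assms[of 2] assms[of 3] exhaust_3[of k]
  by (auto simp: sum_3)

section \<open>Cevian feet, vertex regions and the inner triangle\<close>

text \<open>Along the line through \<open>y k\<close> and \<open>M\<close> the other two coordinates
  keep their ratio; at the foot they are rescaled to sum to 1.\<close>

lemma bary_cevian_foot:
  assumes pos: "\<And>j. 0 < bary y M j"
  shows "bary y (cevian_foot y M k) j = (if j = k then 0 else bary y M j / (1 - bary y M k))"
proof -
  \<comment> \<open>The solution of \<open>(1 - t) + t * bary y M k = 0\<close>, the vanishing of
    coordinate \<open>k\<close> on the line.\<close>
  define t where "t = 1 / (1 - bary y M k)"
  have t: "t * (1 - bary y M k) = 1" "t > 0" using bary_less_1[OF pos, of k] by (simp_all add: t_def)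
  define p where "p = (1 - t) *\<^sub>R y k + t *\<^sub>R M"
  have bp: "bary y p j = (if j = k then 0 else bary y M j / (1 - bary y M k))" for j
  proof -
    have "bary y p j = (1 - t) * (if j = k then 1 else 0) + t * bary y M j"
      unfolding p_def by (simp add: bary_affine_comb bary_vertex)
    then show ?thesis using t(1) by (cases "j = k") (simp_all add: right_diff_distrib t_def)
  qed
  have "cevian_foot y M k = p"
    unfolding cevian_foot_def
  proof (rule the_equality)
    have "0 \<le> bary y p j" for j
      unfolding bp using pos[of j] bary_less_1[OF pos, of k] by simp
    moreover have "p \<in> affine hull {y k, M}"
      unfolding affine_hull_2 p_def by force
    ultimately show "p \<in> affine hull {y k, M} \<and> p \<in> opp_edge y k"
      by (auto simp: opp_edge_eq closed_triangle_eq bp)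
  next
    fix q assume q: "q \<in> affine hull {y k, M} \<and> q \<in> opp_edge y k"
    then obtain u w where uw: "q = u *\<^sub>R y k + w *\<^sub>R M" "u + w = 1"
      unfolding affine_hull_2 by auto
    then have "u + w * bary y M k = 0"
      using q by (simp add: opp_edge_eq bary_affine_comb bary_vertex)
    then have "w * (1 - bary y M k) = 1" using uw(2) by (simp add: algebra_simps)
    then have "w = t" using t bary_less_1[OF pos, of k] by (simp add: t_def field_simps)
    then show "q = p" using uw by (simp add: p_def eq_diff_eq)
  qed
  then show ?thesis using bp by simp
qed

text \<open>By convexity only the corners of the quadrilateral matter. Relative to \<open>M\<close>,
  the coordinates at \<open>y j\<close> vanish except the \<open>j\<close>-th, those at
  \<open>M\<close> are all 1, and at the foot on edge \<open>i\<close> all but the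
  \<open>i\<close>-th equal \<open>1 / (1 - bary y M i)\<close>. Cross-multiplication makes the
  condition a half-plane.\<close>

lemma vertex_region_bary_le:
  assumes pos: "\<And>j. 0 < bary y M j" and x: "x \<in> vertex_region y M j"
  shows "bary y M j * bary y x k \<le> bary y M k * bary y x j"
proof -
  have "vertex_region y M j \<subseteq> {x. bary y M j * bary y x k \<le> bary y M k * bary y x j}"
    unfolding vertex_region_def
  proof (rule hull_minimal)
    have "bary y M j * bary y (cevian_foot y M i) k \<le> bary y M k * bary y (cevian_foot y M i) j"
      if "i \<noteq> j" for i
      using that pos[of j] pos[of k] bary_less_1[OF pos, of i]
      by (auto simp: bary_cevian_foot[OF pos] mult.commute)
    then show "{y j, M} \<union> cevian_foot y M ` (- {j})
        \<subseteq> {x. bary y M j * bary y x k \<le> bary y M k * bary y x j}"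
      using pos[of k] by (auto simp: bary_vertex less_imp_le)
  qed (rule convex_bary_le)
  with x show ?thesis by blast
qed

text \<open>Sum the ratio comparison over \<open>k\<close>; both families of coordinates sum to
  1.\<close>

lemma vertex_region_bary_ge:
  assumes pos: "\<And>j. 0 < bary y M j" and x: "x \<in> vertex_region y M j"
  shows "bary y M j \<le> bary y x j"
proof -
  have "(\<Sum>k\<in>UNIV. bary y M j * bary y x k) \<le> (\<Sum>k\<in>UNIV. bary y M k * bary y x j)"
    by (intro sum_mono vertex_region_bary_le assms)
  then show ?thesis
    by (simp add: sum_bary[OF noncollinear] flip: sum_distrib_left sum_distrib_right)
qed

text \<open>Otherwise a small move from \<open>M\<close> straight away from \<open>y j\<close> would
  lower coordinate \<open>j\<close> below the bound while staying in a ball inside the inner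
  triangle.\<close>

lemma interior_inner_triangle_bary:
  assumes M: "M \<in> interior (inner_triangle y r)" and "r \<ge> 1"
  shows "1 - 1 / r < bary y M j"
proof (rule ccontr)
  assume "\<not> 1 - 1 / r < bary y M j"
  then have le: "bary y M j \<le> 1 - 1 / r" by simp
  obtain e where e: "e > 0" "ball M e \<subseteq> inner_triangle y r"
    using M mem_interior by blast
  \<comment> \<open>The summand 1 keeps the denominator positive and makes the displacement strictly
    shorter than \<open>e\<close>.\<close>
  define s where "s = e / (norm (y j - M) + 1)"
  have s: "s > 0" "s * norm (y j - M) < e"
    using e by (auto simp: s_def field_simps add_pos_nonneg)
  define z where "z = (- s) *\<^sub>R y j + (1 + s) *\<^sub>R M"
  have "M - z = s *\<^sub>R (y j - M)" by (simp add: z_def algebra_simps)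
  then have "dist M z < e" using s by (simp add: dist_norm)
  then have "1 - 1 / r \<le> bary y z j" using e by (auto simp: inner_triangle_def)
  also have "bary y z j = bary y M j - s * (1 - bary y M j)"
    unfolding z_def by (subst bary_affine_comb) (simp_all add: bary_vertex algebra_simps)
  also have "s * (1 - bary y M j) > 0"
  proof (rule mult_pos_pos)
    have "1 / r > 0" using \<open>r \<ge> 1\<close> by simp
    then show "1 - bary y M j > 0" using le by linarith
  qed (rule s)
  then have "bary y M j - s * (1 - bary y M j) < bary y M j" by simp
  finally show False using le by simp
qed

end

section \<open>Domination numbers in terms of index sets\<close>

text \<open>The full vertex set dominates, so the \<open>LEAST\<close> is attained.\<close>

lemma domination_number_le_iff:
  assumes "finite (verts G)"
  shows "domination_number G \<le> k \<longleftrightarrow> (\<exists>S. dominating_set G S \<and> card S \<le> k)"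
proof
  let ?Q = "\<lambda>k. \<exists>S. finite S \<and> dominating_set G S \<and> card S = k"
  have "?Q (card (verts G))"
    using assms by (intro exI[of _ "verts G"]) (simp add: dominating_set_def)
  then have "?Q (domination_number G)"
    unfolding domination_number_def by (rule LeastI)
  then show "\<exists>S. dominating_set G S \<and> card S \<le> k" if "domination_number G \<le> k"
    using that by auto
next
  assume "\<exists>S. dominating_set G S \<and> card S \<le> k"
  then obtain S where S: "dominating_set G S" "card S \<le> k" by blast
  then have "finite S" using assms by (auto simp: dominating_set_def intro: finite_subset)
  then have "domination_number G \<le> card S"
    unfolding domination_number_def using S by (intro Least_le) auto
  with S show "domination_number G \<le> k" by simp
qed

text \<open>Indices replace points so that, for random \<open>f\<close>, the quantifiers range over
  fixed finite sets and measurability reduces to single arcs. The alternative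
  \<open>f i = f j\<close> accounts for members of the dominating set, including coinciding
  points.\<close>

lemma pe_domination_number_le_iff:
  fixes f :: "nat \<Rightarrow> real^2"
  shows "domination_number (with_proj (pe_digraph y v r (f ` {..<n}))) \<le> k \<longleftrightarrow>
    (\<exists>J\<in>Pow {..<n}. card J \<le> k \<and> (\<forall>i\<in>{..<n}. \<exists>j\<in>J. f i = f j \<or> f i \<in> pe_region y v r (f j)))"
    (is "domination_number ?G \<le> k \<longleftrightarrow> (\<exists>J\<in>_. _ \<and> ?dom J)")
proof -
  have dom: "dominating_set ?G (f ` J) \<longleftrightarrow> ?dom J" if "J \<subseteq> {..<n}" for J
  proof -
    have "(f i \<in> f ` J \<or> (\<exists>u\<in>f ` J. u \<rightarrow>\<^bsub>?G\<^esub> f i)) \<longleftrightarrow>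
        (\<exists>j\<in>J. f i = f j \<or> f i \<in> pe_region y v r (f j))" if "i < n" for i
    proof -
      have "(f i = f j \<or> f j \<rightarrow>\<^bsub>?G\<^esub> f i) \<longleftrightarrow> (f i = f j \<or> f i \<in> pe_region y v r (f j))" if "j \<in> J" for j
        using \<open>J \<subseteq> {..<n}\<close> \<open>i < n\<close> that by (auto simp: pe_digraph_def)
      note bex_cong[OF refl this]
      moreover have "(f i \<in> f ` J \<or> (\<exists>u\<in>f ` J. u \<rightarrow>\<^bsub>?G\<^esub> f i)) \<longleftrightarrow>
          (\<exists>j\<in>J. f i = f j \<or> f j \<rightarrow>\<^bsub>?G\<^esub> f i)"
        unfolding Set.bex_simps(7) image_iff bex_disj_distrib ..
      ultimately show ?thesis by (rule trans[rotated])
    qed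
    moreover have "f ` J \<subseteq> f ` {..<n}" using that by blast
    moreover have "verts ?G = f ` {..<n}" by (simp add: pe_digraph_def)
    ultimately show ?thesis by (simp add: dominating_set_def del: with_proj_simps(3))
  qed
  show ?thesis
  proof (subst domination_number_le_iff)
    show "(\<exists>S. dominating_set ?G S \<and> card S \<le> k) \<longleftrightarrow> (\<exists>J\<in>Pow {..<n}. card J \<le> k \<and> ?dom J)"
    proof
      assume "\<exists>S. dominating_set ?G S \<and> card S \<le> k"
      then obtain S where S: "dominating_set ?G S" "card S \<le> k" by blast
      then have "S \<subseteq> f ` {..<n}" by (simp add: dominating_set_def pe_digraph_def)
      \<comment> \<open>One index per point, so that \<open>J\<close> is no larger than
        \<open>S\<close>.\<close>
      then obtain J where "J \<subseteq> {..<n}" "inj_on f J" "S = f ` J" using subset_image_inj by metis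
      then show "\<exists>J\<in>Pow {..<n}. card J \<le> k \<and> ?dom J"
        using S dom[of J] by (intro bexI[of _ J]) (auto simp: card_image)
    next
      assume "\<exists>J\<in>Pow {..<n}. card J \<le> k \<and> ?dom J"
      then obtain J where J: "J \<subseteq> {..<n}" "card J \<le> k" "?dom J" by blast
      have "finite J" using J(1) by (rule finite_subset) simp
      then have "card (f ` J) \<le> k" using order_trans[OF card_image_le J(2)] by blast
      with J dom[of J] show "\<exists>S. dominating_set ?G S \<and> card S \<le> k" by blast
    qed
  qed (simp add: pe_digraph_def)
qed

section \<open>The deterministic criterion for domination number three\<close>

context triangle
begin

definition corner :: "(3 \<Rightarrow> real) \<Rightarrow> 3 \<Rightarrow> (real^2) set" where
  "corner d l = {z \<in> closed_triangle y. \<forall>j. j \<noteq> l \<longrightarrow> bary y z j < d j}"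

text \<open>The deterministic core: all that the random sample must provide is collected in the two
  hypotheses on \<open>f\<close>.\<close>

lemma pe_domination_number_eq_3:
  fixes f :: "nat \<Rightarrow> real^2"
  assumes M: "M \<in> interior (inner_triangle y r)" and r: "r \<ge> 1" and v: "vertex_assignment y M v"
    and f: "\<And>i. i < n \<Longrightarrow> f i \<in> closed_triangle y - range y"
    and corners: "\<And>l. \<exists>i<n. f i \<in> corner (\<lambda>j. 1 - r * (1 - bary y M j)) l"
  shows "domination_number (with_proj (pe_digraph y v r (f ` {..<n}))) = 3"
proof -
  let ?\<gamma> = "domination_number (with_proj (pe_digraph y v r (f ` {..<n})))"
  have pos: "0 < bary y M j" for j
  proof -
    have "0 \<le> 1 - 1 / r" using r by simp
    then show ?thesis using interior_inner_triangle_bary[OF M r, of j] by linarith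
  qed
  have le1: "bary y x j \<le> 1" if "x \<in> closed_triangle y" for x j
    using that sum_bary[OF noncollinear, of x] member_le_sum[of j UNIV "bary y x"]
    by (auto simp: closed_triangle_eq)
  have pe: "f i \<in> pe_region y v r (f j) \<longleftrightarrow> 1 - bary y (f i) (v (f j)) \<le> r * (1 - bary y (f j) (v (f j)))"
    if "i < n" "j < n" for i j
    using f[OF that(1)] f[OF that(2)] by (simp add: pe_region_def)
  \<comment> \<open>As \<open>r\<close> is at least 1, a point covers all data lying no farther than
    itself from its assigned vertex, measured perpendicular to the opposite edge.\<close>
  have pe_le: "f i \<in> pe_region y v r (f j)"
    if ij: "i < n" "j < n" "bary y (f j) (v (f j)) \<le> bary y (f i) (v (f j))" for i j
  proof -
    have "1 - bary y (f i) (v (f j)) \<le> 1 * (1 - bary y (f j) (v (f j)))" using ij by simp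
    also have "\<dots> \<le> r * (1 - bary y (f j) (v (f j)))"
      using r f[OF ij(2)] le1 by (intro mult_right_mono) auto
    finally show ?thesis using pe ij by simp
  qed
  have "?\<gamma> \<le> 3"
  proof -
    define I where "I k = {i. i < n \<and> v (f i) = k}" for k
    \<comment> \<open>Vertices without assigned data are left out, since a minimizer needs a
      nonempty set.\<close>
    define K where "K = {k. I k \<noteq> {}}"
    define g where "g k = arg_min_on (\<lambda>i. bary y (f i) k) (I k)" for k
    have fin: "finite (I k)" for k by (simp add: I_def)
    have g: "g k \<in> I k" "\<And>i. i \<in> I k \<Longrightarrow> bary y (f (g k)) k \<le> bary y (f i) k" if "k \<in> K" for k
      using that fin[of k] unfolding g_def K_def
      by (auto intro: arg_min_if_finite(1) arg_min_least)
    have "card (g ` K) \<le> card K" by (rule card_image_le) simp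
    also have "\<dots> \<le> card (UNIV :: 3 set)" by (rule card_mono) auto
    finally have "card (g ` K) \<le> 3" by simp
    moreover have "g ` K \<subseteq> {..<n}" using g(1) by (auto simp: I_def)
    moreover have "\<exists>j\<in>g ` K. f i = f j \<or> f i \<in> pe_region y v r (f j)" if "i < n" for i
    proof -
      have i: "i \<in> I (v (f i))" "v (f i) \<in> K" using that by (auto simp: I_def K_def)
      have "f i \<in> pe_region y v r (f (g (v (f i))))"
        using g(1)[OF i(2)] g(2)[OF i(2) i(1)] that by (intro pe_le) (auto simp: I_def)
      with i(2) show ?thesis by blast
    qed
    ultimately show ?thesis unfolding pe_domination_number_le_iff by blast
  qed
  moreover have "\<not> ?\<gamma> \<le> 2"
  proof
    assume "?\<gamma> \<le> 2"
    then obtain J where J: "J \<subseteq> {..<n}" "card J \<le> 2"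
      and dom: "\<And>i. i < n \<Longrightarrow> \<exists>j\<in>J. f i = f j \<or> f i \<in> pe_region y v r (f j)"
      unfolding pe_domination_number_le_iff by blast
    have "card ((\<lambda>j. v (f j)) ` J) < card (UNIV :: 3 set)"
      using J card_image_le[of J "\<lambda>j. v (f j)"] finite_subset[OF J(1)] by simp
    then obtain l where l: "l \<notin> (\<lambda>j. v (f j)) ` J" by (metis UNIV_eq_I less_irrefl)
    obtain i where i: "i < n" "f i \<in> corner (\<lambda>j. 1 - r * (1 - bary y M j)) l" using corners by blast
    obtain j where j: "j \<in> J" "f i = f j \<or> f i \<in> pe_region y v r (f j)" using dom[OF i(1)] by blast
    then have "j < n" using J by auto
    let ?k = "v (f j)"
    have "f i \<in> pe_region y v r (f j)" using j pe_le[of i j] i \<open>j < n\<close> by auto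
    then have "1 - bary y (f i) ?k \<le> r * (1 - bary y (f j) ?k)" using pe i \<open>j < n\<close> by simp
    also have "\<dots> \<le> r * (1 - bary y M ?k)"
      using v f[OF \<open>j < n\<close>] vertex_region_bary_ge[OF pos, of "f j" ?k] r
      by (intro mult_left_mono) (auto simp: vertex_assignment_def)
    finally have "1 - r * (1 - bary y M ?k) \<le> bary y (f i) ?k" by simp
    moreover have "?k \<noteq> l" using l j by blast
    ultimately show False using i by (force simp: corner_def)
  qed
  ultimately show ?thesis by simp
qed

section \<open>Lebesgue measure of corners and of the region boundaries\<close>

lemma compact_closed_triangle: "compact (closed_triangle y)"
  unfolding closed_triangle_def by (intro compact_convex_hull finite_imp_compact) simp

lemma closed_triangle_borel [measurable]: "closed_triangle y \<in> sets borel"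
  using compact_closed_triangle by (simp add: borel_compact)

lemma corner_borel [measurable]: "corner d l \<in> sets borel"
proof -
  have "{z \<in> space borel. z \<in> closed_triangle y \<and> (\<forall>j. j \<noteq> l \<longrightarrow> bary y z j < d j)} \<in> sets borel"
    by measurable
  then show ?thesis by (simp add: corner_def)
qed

text \<open>The corner contains a nonempty open set, which cannot be negligible.\<close>

lemma emeasure_corner_pos:
  assumes d: "\<And>j. 0 < d j"
  shows "0 < emeasure lborel (corner d l)"
proof -
  define U where "U = {z. (\<forall>j. 0 < bary y z j) \<and> (\<forall>j. j \<noteq> l \<longrightarrow> bary y z j < d j)}"
  have "open U"
  proof -
    have "U = (\<Inter>j\<in>UNIV. {z. 0 < bary y z j}) \<inter> (\<Inter>j\<in>-{l}. {z. bary y z j < d j})"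
      by (auto simp: U_def)
    also have "open \<dots>"
      by (intro open_Int open_INT ballI finite open_Collect_less continuous_on_bary continuous_on_const)
    finally show ?thesis .
  qed
  \<comment> \<open>Weight \<open>e\<close> on two vertices and \<open>1 - 2 * e\<close> on
    \<open>y l\<close> gives a point of \<open>U\<close>: \<open>e\<close> is below every
    \<open>d j\<close>, and \<open>1 - 2 * e\<close> stays positive.\<close>
  define e where "e = min (1/3) (Min (range d)) / 2"
  have "Min (range d) > 0" using d by simp
  then have e: "0 < e" "e \<le> 1/6" by (auto simp: e_def)
  have ed: "e < d j" for j
  proof -
    have "Min (range d) \<le> d j" by simp
    then show ?thesis using \<open>Min (range d) > 0\<close> unfolding e_def by linarith
  qed
  define b where "b j = (if j = l then 1 - 2 * e else e)" for j :: 3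
  have "(\<Sum>j\<in>UNIV. b j) = 1"
    using exhaust_3[of l] by (auto simp: sum_3 b_def)
  then have "bary y (\<Sum>j\<in>UNIV. b j *\<^sub>R y j) = b"
    by (rule bary_unique[OF noncollinear]) simp
  then have "(\<Sum>j\<in>UNIV. b j *\<^sub>R y j) \<in> U"
    using e ed by (auto simp: U_def b_def)
  then have "\<not> negligible U" using \<open>open U\<close> open_not_negligible by blast
  then have "U \<notin> null_sets lborel" using \<open>open U\<close>
    by (simp add: negligible_iff_null_sets null_sets_completion_iff)
  then have "0 < emeasure lborel U" using \<open>open U\<close> by (auto simp: null_sets_def zero_less_iff_neq_zero)
  also have "U \<subseteq> corner d l" by (auto simp: U_def corner_def closed_triangle_eq less_imp_le)
  then have "emeasure lborel U \<le> emeasure lborel (corner d l)" by (intro emeasure_mono) auto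
  finally show ?thesis .
qed

text \<open>Ties satisfy an affine equation that fails at \<open>y k\<close>, so they fill at most a
  line.\<close>

lemma AE_no_tie:
  assumes m: "0 < m (j::3)" and jk: "j \<noteq> k"
  shows "AE x in lborel. m k * bary y x j \<noteq> m j * bary y x k"
proof -
  obtain a c where ac: "\<And>x j. bary y x j = a j \<bullet> x + c j"
    using bary_affine[OF noncollinear] by blast
  let ?a = "m k *\<^sub>R a j - m j *\<^sub>R a k" and ?c = "m j * c k - m k * c j"
  have eq: "m k * bary y x j = m j * bary y x k \<longleftrightarrow> ?a \<bullet> x = ?c" for x
    by (auto simp: ac algebra_simps)
  have "?a \<noteq> 0 \<or> ?c \<noteq> 0"
    using eq[of "y k"] m jk by (auto simp: bary_vertex)
  then have "negligible {x. m k * bary y x j = m j * bary y x k}"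
    unfolding eq by (rule negligible_hyperplane)
  moreover have "{x \<in> space borel. m k * bary y x j = m j * bary y x k} \<in> sets borel" by measurable
  ultimately have "{x. m k * bary y x j = m j * bary y x k} \<in> null_sets lborel"
    by (simp add: negligible_iff_null_sets null_sets_completion_iff)
  from AE_not_in[OF this] show ?thesis by simp
qed

text \<open>Off the ties the arbitrary choice in \<open>v\<close> disappears: \<open>v x\<close> is
  the unique index of largest ratio. This replaces \<open>v\<close> by a Borel condition almost
  everywhere.\<close>

lemma AE_vertex_assignment:
  assumes pos: "\<And>j. 0 < bary y M j" and v: "vertex_assignment y M v"
  shows "AE x in uniform_measure lborel (closed_triangle y).
     x \<in> closed_triangle y - range y \<and>
     (\<forall>k. v x = k \<longleftrightarrow> (\<forall>j. j \<noteq> k \<longrightarrow> bary y M k * bary y x j < bary y M j * bary y x k))"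
proof (rule AE_uniform_measureI)
  have "AE x in lborel. \<forall>j k. j \<noteq> k \<longrightarrow> bary y M k * bary y x j \<noteq> bary y M j * bary y x k"
    by (subst AE_all_countable, intro allI, subst AE_all_countable, intro allI)
       (use AE_no_tie[of "bary y M", OF pos] in auto)
  moreover have "AE x in lborel. x \<notin> range y"
    by (intro AE_not_in finite_imp_null_set_lborel) simp
  ultimately show "AE x in lborel. x \<in> closed_triangle y \<longrightarrow> x \<in> closed_triangle y - range y \<and>
     (\<forall>k. v x = k \<longleftrightarrow> (\<forall>j. j \<noteq> k \<longrightarrow> bary y M k * bary y x j < bary y M j * bary y x k))"
  proof eventually_elim
    case (elim x)
    show ?case
    proof
      assume "x \<in> closed_triangle y"
      with elim have x: "x \<in> closed_triangle y - range y" by blast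
      then have "x \<in> vertex_region y M (v x)" using v by (simp add: vertex_assignment_def)
      then have le: "bary y M (v x) * bary y x j \<le> bary y M j * bary y x (v x)" for j
        by (rule vertex_region_bary_le[OF pos])
      show "x \<in> closed_triangle y - range y \<and>
        (\<forall>k. v x = k \<longleftrightarrow> (\<forall>j. j \<noteq> k \<longrightarrow> bary y M k * bary y x j < bary y M j * bary y x k))"
      proof (intro conjI allI iffI impI)
        show "bary y M k * bary y x j < bary y M j * bary y x k" if "v x = k" "j \<noteq> k" for k j
          using le[of j] elim that by (auto simp: less_le)
        show "v x = k" if *: "\<forall>j. j \<noteq> k \<longrightarrow> bary y M k * bary y x j < bary y M j * bary y x k" for k
          using le[of k] * by (metis not_le)
      qed (use x in auto)
    qed
  qed
qed simp

end

section \<open>Random samples and the limit\<close>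

lemma (in prob_space) prob_indep_vars_all_miss:
  fixes X :: "nat \<Rightarrow> 'a \<Rightarrow> 'b"
  assumes X: "indep_vars (\<lambda>_. N) X UNIV" and B: "B \<in> sets N"
    and p: "\<And>i. prob (X i -` B \<inter> space M) = p"
  shows "prob {\<omega> \<in> space M. \<forall>i<n. X i \<omega> \<notin> B} = (1 - p) ^ n"
\<comment> \<open>The product rule for independent events is applied to a nonempty index set, so the
  empty sample is treated apart.\<close>
proof (cases "n = 0")
  case False
  have rv: "X i \<in> measurable M N" for i using X by (auto simp: indep_vars_def)
  have miss: "X i -` (space N - B) \<inter> space M = space M - (X i -` B \<inter> space M)" for i
    using measurable_space[OF rv] by auto
  have "{\<omega> \<in> space M. \<forall>i<n. X i \<omega> \<notin> B} = (\<Inter>i\<in>{..<n}. X i -` (space N - B) \<inter> space M)"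
    using False unfolding miss by auto
  also have "prob \<dots> = (\<Prod>i<n. prob (X i -` (space N - B) \<inter> space M))"
    using False B by (intro indep_varsD[OF X]) auto
  also have "\<dots> = (1 - p) ^ n"
    unfolding miss using measurable_sets[OF rv B] by (simp add: prob_compl p)
  finally show ?thesis .
qed (simp add: prob_space)

theorem theorem6:
  fixes y :: "3 \<Rightarrow> real^2" and r :: real and M :: "real^2" and v :: "real^2 \<Rightarrow> 3"
    and P :: "'w measure" and X :: "nat \<Rightarrow> 'w \<Rightarrow> real^2"
  assumes "\<not> collinear (range y)"
    and "r \<ge> 1"
    and "M \<in> interior (inner_triangle y r)"
    and "vertex_assignment y M v"
    and "prob_space P"
    and "prob_space.indep_vars P (\<lambda>_. borel) X UNIV"
    and "\<And>i. distr P borel (X i) = uniform_measure lborel (closed_triangle y)"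
  shows "(\<lambda>n. measure (completion P)
            {\<omega> \<in> space P.
               domination_number (with_proj (pe_digraph y v r ((\<lambda>i. X i \<omega>) ` {..<n}))) = 3})
         \<longlonglongrightarrow> 1"
proof -
  interpret triangle y by unfold_locales fact
  interpret prob_space P by fact
  interpret completion: prob_space "completion P" by (rule prob_space_completion)
  note r = assms(2) and M = assms(3) and v = assms(4) and indep = assms(6) and unif = assms(7)
  let ?T = "closed_triangle y"
  let ?\<gamma> = "\<lambda>n \<omega>. domination_number (with_proj (pe_digraph y v r ((\<lambda>i. X i \<omega>) ` {..<n})))"
  define d where "d j = 1 - r * (1 - bary y M j)" for j
  have gt: "1 - 1 / r < bary y M j" for j by (rule interior_inner_triangle_bary[OF M r])
  have pos: "0 < bary y M j" for j
  proof -
    have "0 \<le> 1 - 1 / r" using r by simp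
    then show ?thesis using gt[of j] by linarith
  qed
  have d_pos: "0 < d j" for j
  proof -
    \<comment> \<open>The left side is \<open>r - 1\<close>, so this strict inequality is exactly
      the positivity of the strip width \<open>d j\<close>.\<close>
    have "r * (1 - 1 / r) < r * bary y M j" using gt[of j] r by (intro mult_strict_left_mono) auto
    then show ?thesis using r by (simp add: d_def algebra_simps)
  qed
  have rv [measurable]: "X i \<in> borel_measurable P" for i
    using indep by (auto simp: indep_vars_def)

  have AE_X: "AE \<omega> in P. \<forall>i. X i \<omega> \<in> ?T - range y \<and>
     (\<forall>k. v (X i \<omega>) = k \<longleftrightarrow>
       (\<forall>j. j \<noteq> k \<longrightarrow> bary y M k * bary y (X i \<omega>) j < bary y M j * bary y (X i \<omega>) k))"
  proof (subst AE_all_countable, intro allI AE_distrD[OF rv])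
    fix i show "AE x in distr P borel (X i). x \<in> ?T - range y \<and>
       (\<forall>k. v x = k \<longleftrightarrow> (\<forall>j. j \<noteq> k \<longrightarrow> bary y M k * bary y x j < bary y M j * bary y x k))"
      unfolding unif by (rule AE_vertex_assignment[OF pos v])
  qed

  \<comment> \<open>\<open>v\<close> need not be measurable on the common boundaries of the vertex regions, so arcs are
    events only up to a null set.\<close>
  have arc: "{\<omega> \<in> space P. X i \<omega> = X j \<omega> \<or> X i \<omega> \<in> pe_region y v r (X j \<omega>)} \<in> sets (completion P)"
    for i j
  proof (rule completion.in_sets_AE)
    \<comment> \<open>A measurable substitute in which the strict ratio condition on
      \<open>k\<close> stands for \<open>v (X j \<omega>) = k\<close>.\<close>
    let ?A = "{\<omega> \<in> space P. X i \<omega> = X j \<omega> \<or> (\<exists>k.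
      (\<forall>l. l \<noteq> k \<longrightarrow> bary y M k * bary y (X j \<omega>) l < bary y M l * bary y (X j \<omega>) k) \<and>
      1 - bary y (X i \<omega>) k \<le> r * (1 - bary y (X j \<omega>) k))}"
    have "?A \<in> sets P" by measurable
    then show "?A \<in> sets (completion P)" by simp
    show "AE \<omega> in completion P. \<omega> \<in> ?A \<longleftrightarrow>
        \<omega> \<in> {\<omega> \<in> space P. X i \<omega> = X j \<omega> \<or> X i \<omega> \<in> pe_region y v r (X j \<omega>)}"
      using AE_completion[OF AE_X]
    proof eventually_elim
      case (elim \<omega>)
      then have *: "(\<forall>l. l \<noteq> k \<longrightarrow>
          bary y M k * bary y (X j \<omega>) l < bary y M l * bary y (X j \<omega>) k) \<longleftrightarrow> v (X j \<omega>) = k" for k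
        by blast
      have "X i \<omega> \<in> ?T" "X j \<omega> \<notin> range y" using elim by auto
      then show ?case by (simp add: pe_region_def *)
    qed
  qed auto
  have dom_le: "{\<omega> \<in> space P. ?\<gamma> n \<omega> \<le> k} \<in> sets (completion P)" for n k
  proof -
    have "{\<omega> \<in> space P. ?\<gamma> n \<omega> \<le> k} = {\<omega> \<in> space (completion P). \<exists>J\<in>Pow {..<n}. card J \<le> k \<and>
        (\<forall>i\<in>{..<n}. \<exists>j\<in>J. X i \<omega> = X j \<omega> \<or> X i \<omega> \<in> pe_region y v r (X j \<omega>))}"
      by (simp add: pe_domination_number_le_iff)
    also have "\<dots> \<in> sets (completion P)"
      by (intro sets.sets_Collect_finite_Ex sets.sets_Collect_conj sets.sets_Collect_finite_All
          sets.sets_Collect_const) (auto intro: finite_subset arc)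
    finally show ?thesis .
  qed
  \<comment> \<open>Needed for the lower bound, since \<open>measure\<close> is 0 by default on
    nonmeasurable sets.\<close>
  have event: "{\<omega> \<in> space P. ?\<gamma> n \<omega> = 3} \<in> sets (completion P)" for n
  proof -
    have "{\<omega> \<in> space P. ?\<gamma> n \<omega> = 3} = {\<omega> \<in> space P. ?\<gamma> n \<omega> \<le> 3} - {\<omega> \<in> space P. ?\<gamma> n \<omega> \<le> 2}"
      by auto
    also have "\<dots> \<in> sets (completion P)" by (rule sets.Diff[OF dom_le dom_le])
    finally show ?thesis .
  qed

  define p where "p l = measure (uniform_measure lborel ?T) (corner d l)" for l
  have p: "prob (X i -` corner d l \<inter> space P) = p l" for i l
    unfolding p_def unif[of i, symmetric] by (simp add: measure_distr)
  have p01: "0 < p l" "p l \<le> 1" for l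
  proof -
    have T: "corner d l \<subseteq> ?T" by (auto simp: corner_def)
    \<comment> \<open>With finite positive area of the triangle, \<open>p l\<close> is a genuine
      ratio of areas.\<close>
    have "emeasure lborel ?T \<noteq> \<infinity>" using emeasure_compact_finite[OF compact_closed_triangle] by simp
    moreover have "0 < emeasure lborel (corner d l)" by (rule emeasure_corner_pos[OF d_pos])
    moreover have "emeasure lborel (corner d l) \<le> emeasure lborel ?T" using T by (intro emeasure_mono) auto
    ultimately have "0 < measure lborel (corner d l)" "0 < measure lborel ?T"
        "emeasure lborel ?T \<noteq> 0" "emeasure lborel ?T \<noteq> \<infinity>"
      by (auto simp: measure_def enn2real_positive_iff less_top top_unique)
    then show "0 < p l" using T by (simp add: p_def Int_absorb1)
    show "p l \<le> 1" using p[of 0 l] prob_le_1 by metis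
  qed

  have lower: "1 - (\<Sum>l\<in>UNIV. (1 - p l) ^ n) \<le> measure (completion P) {\<omega> \<in> space P. ?\<gamma> n \<omega> = 3}" for n
  proof -
    let ?B = "\<lambda>l. {\<omega> \<in> space P. \<forall>i<n. X i \<omega> \<notin> corner d l}"
    have B: "?B l \<in> sets P" for l by measurable
    \<comment> \<open>Union bound over the three corners; outside the union every corner is hit and
      the deterministic criterion applies almost surely.\<close>
    have "prob (\<Union>l\<in>UNIV. ?B l) \<le> (\<Sum>l\<in>UNIV. prob (?B l))"
      using B by (intro finite_measure_subadditive_finite) auto
    also have "\<dots> = (\<Sum>l\<in>UNIV. (1 - p l) ^ n)"
      using prob_indep_vars_all_miss[OF indep corner_borel p] by simp
    finally have "1 - (\<Sum>l\<in>UNIV. (1 - p l) ^ n) \<le> 1 - prob (\<Union>l\<in>UNIV. ?B l)" by simp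
    also have "\<dots> = prob (space P - (\<Union>l\<in>UNIV. ?B l))" using B by (subst prob_compl) auto
    also have "\<dots> = measure (completion P) (space P - (\<Union>l\<in>UNIV. ?B l))"
      using B by (subst measure_completion) auto
    also have "\<dots> \<le> measure (completion P) {\<omega> \<in> space P. ?\<gamma> n \<omega> = 3}"
    proof (rule completion.finite_measure_mono_AE[OF _ event])
      show "AE \<omega> in completion P. \<omega> \<in> space P - (\<Union>l\<in>UNIV. ?B l) \<longrightarrow> \<omega> \<in> {\<omega> \<in> space P. ?\<gamma> n \<omega> = 3}"
        using AE_completion[OF AE_X]
      proof eventually_elim
        case (elim \<omega>)
        show ?case
        proof
          assume \<omega>: "\<omega> \<in> space P - (\<Union>l\<in>UNIV. ?B l)"
          have "?\<gamma> n \<omega> = 3"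
          proof (rule pe_domination_number_eq_3[OF M r v])
            show "X i \<omega> \<in> ?T - range y" for i using elim by blast
            show "\<exists>i<n. X i \<omega> \<in> corner (\<lambda>j. 1 - r * (1 - bary y M j)) l" for l
              using \<omega> by (auto simp: d_def[abs_def])
          qed
          with \<omega> show "\<omega> \<in> {\<omega> \<in> space P. ?\<gamma> n \<omega> = 3}" by blast
        qed
      qed
    qed
    finally show ?thesis .
  qed
  have "(\<lambda>n. (1 - p l) ^ n) \<longlonglongrightarrow> 0" for l
    using p01[of l] by (intro LIMSEQ_power_zero) simp
  then have "(\<lambda>n. \<Sum>l\<in>UNIV. (1 - p l) ^ n) \<longlonglongrightarrow> 0"
    by (intro tendsto_null_sum) simp
  then have "(\<lambda>n. 1 - (\<Sum>l\<in>UNIV. (1 - p l) ^ n)) \<longlonglongrightarrow> 1"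
    using tendsto_diff[OF tendsto_const] by fastforce
  then show ?thesis
    by (rule real_tendsto_sandwich[rotated 2, OF _ tendsto_const])
       (use lower completion.prob_le_1 in auto)
qed

end
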